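(* Let $G$ be a graph in $\varepsilon_1$ with $q$ edges, and let $\xi_1$ be the number of cycles in a decomposition of the edge set of $G$ into edge-disjoint cycles. Then $q\equiv \xi_1 \pmod 4$.
   Context: All graphs are finite, simple, undirected and connected. An Euler graph is a connected graph in which every vertex has even degree. $\varepsilon_1$ denotes the class of Euler graphs $G$ such that every cycle of $G$ has length $n\equiv 1 \pmod 4$. A cycle decomposition of a graph is a partition of its edge set into edge sets of cycles. *)

theory Defs
  imports Main "HOL-Library.Disjoint_Sets" "HOL-Number_Theory.Cong"
begin

text \<open>An undirected graph is given by a vertex set \<open>V\<close> and a set \<open>E\<close> of two-element subsets of \<open>V\<close>.\<close>

definition simple_graph :: "'a set \<Rightarrow> 'a set set \<Rightarrow> bool" where
  "simple_graph V E \<longleftrightarrow> finite V \<and> V \<noteq> {} \<and> (\<forall>e\<in>E. e \<subseteq> V \<and> card e = 2)"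

definition adj_rel :: "'a set set \<Rightarrow> ('a \<times> 'a) set" where
  "adj_rel E = {(u, v). {u, v} \<in> E}"

definition graph_connected :: "'a set \<Rightarrow> 'a set set \<Rightarrow> bool" where
  "graph_connected V E \<longleftrightarrow> (\<forall>u\<in>V. \<forall>v\<in>V. (u, v) \<in> (adj_rel E)\<^sup>*)"

definition degree :: "'a set set \<Rightarrow> 'a \<Rightarrow> nat" where
  "degree E v = card {e \<in> E. v \<in> e}"

definition euler_graph :: "'a set \<Rightarrow> 'a set set \<Rightarrow> bool" where
  "euler_graph V E \<longleftrightarrow> simple_graph V E \<and> graph_connected V E \<and> (\<forall>v\<in>V. even (degree E v))"

text \<open>A cycle is represented by the list of its vertices in cyclic order, the first vertex not
  being repeated at the end; hence its length (number of edges) is the length of the list. The same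
  cycle is represented by several lists, which all have the same length and edge set.\<close>

definition cycle_edges :: "'a list \<Rightarrow> 'a set set" where
  "cycle_edges vs = {{vs ! i, vs ! (Suc i mod length vs)} | i. i < length vs}"

definition is_cycle :: "'a set \<Rightarrow> 'a set set \<Rightarrow> 'a list \<Rightarrow> bool" where
  "is_cycle V E vs \<longleftrightarrow>
     length vs \<ge> 3 \<and> distinct vs \<and> set vs \<subseteq> V \<and> cycle_edges vs \<subseteq> E"

definition euler_eps1 :: "'a set \<Rightarrow> 'a set set \<Rightarrow> bool" where
  "euler_eps1 V E \<longleftrightarrow>
     euler_graph V E \<and> (\<forall>vs. is_cycle V E vs \<longrightarrow> [length vs = 1] (mod 4))"

definition cycle_decomposition :: "'a set \<Rightarrow> 'a set set \<Rightarrow> 'a set set set \<Rightarrow> bool" where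
  "cycle_decomposition V E D \<longleftrightarrow>
     partition_on E D \<and> (\<forall>C\<in>D. \<exists>vs. is_cycle V E vs \<and> C = cycle_edges vs)"

end

theory Submission
  imports Defs
begin

text \<open>Counting edges block by block, \<open>q\<close> is the sum of the sizes of the members
  of \<open>D\<close>. Each member is the edge set of a cycle, so by \<open>card_cycle_edges\<close>
  its size is the cycle length, which is 1 modulo 4. Each cycle thus contributes 1 modulo 4, and the
  sum is congruent to the number of cycles.\<close>

text \<open>Mapping each position to the edge towards its cyclic successor is injective. The length
  bound matters: at length 2 both positions give the same edge.\<close>

lemma card_cycle_edges:
  assumes "length vs \<ge> 3" and "distinct vs"
  shows "card (cycle_edges vs) = length vs"
proof -
  let ?n = "length vs"
  let ?f = "\<lambda>i. {vs ! i, vs ! (Suc i mod ?n)}"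
  have "inj_on ?f {..<?n}"
  proof (rule inj_onI)
    fix i j assume i: "i \<in> {..<?n}" and j: "j \<in> {..<?n}" and eq: "?f i = ?f j"
    have lt: "Suc i mod ?n < ?n" "Suc j mod ?n < ?n"
      using assms(1) by (auto intro: mod_less_divisor)
    from eq have "i = j \<or> i = Suc j mod ?n \<and> Suc i mod ?n = j"
      using i j lt assms(2) by (auto simp: doubleton_eq_iff nth_eq_iff_index_eq)
    \<comment> \<open>The second alternative would make i + 2 congruent to i modulo a length of at least 3.\<close>
    then show "i = j"
      using i j assms(1) by (auto simp: mod_Suc split: if_splits)
  qed
  moreover have "cycle_edges vs = ?f ` {..<?n}"
    by (auto simp: cycle_edges_def)
  ultimately show ?thesis
    by (simp add: card_image)
qed

lemma finite_edges:
  assumes "simple_graph V E"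
  shows "finite E"
proof (rule finite_subset)
  show "E \<subseteq> Pow V" and "finite (Pow V)"
    using assms by (auto simp: simple_graph_def)
qed

theorem theorem9:
  fixes V :: "'a set" and E :: "'a set set" and D :: "'a set set set" and q \<xi>\<^sub>1 :: nat
  assumes "euler_eps1 V E"
    and "q = card E"
    and "cycle_decomposition V E D"
    and "\<xi>\<^sub>1 = card D"
  shows "[q = \<xi>\<^sub>1] (mod 4)"
proof -
  have part: "partition_on E D"
    using assms(3) by (simp add: cycle_decomposition_def)
  have fin: "finite E"
    using assms(1) by (auto simp: euler_eps1_def euler_graph_def intro: finite_edges)
  have "card E = (\<Sum>C\<in>D. card C)"
    using product_partition[OF part] finite_elements[OF fin part] partition_onD1[OF part] fin
    by (auto intro: finite_subset)
  \<comment> \<open>The hypothesis on lengths concerns vertex lists; \<open>card_cycle_edges\<close>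
    carries it over to the edge set \<open>C\<close>.\<close>
  moreover have "[card C = 1] (mod 4)" if "C \<in> D" for C
    using that assms(1,3)
    by (fastforce simp: cycle_decomposition_def euler_eps1_def is_cycle_def card_cycle_edges)
  \<comment> \<open>The sum of ones is \<open>card D\<close>, so the congruences add up
    termwise.\<close>
  then have "[(\<Sum>C\<in>D. card C) = (\<Sum>C\<in>D. 1)] (mod 4)"
    by (rule cong_sum)
  ultimately show ?thesis
    using assms(2,4) by simp
qed

end
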